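(* Let $a,b$ be coprime positive integers, let $\alpha_a,\alpha_b,\beta_a,\beta_b$ be constants, and let $f$ be a function satisfying $$f\left(\frac{ia}{b}\right)=\alpha_a\sum_{j=0}^{a-1}f\left(\frac{i}{b}+\frac{j}{a}\right)+\beta_a\quad (i=0,1,\dots,b-1),$$ $$f\left(\frac{jb}{a}\right)=\alpha_b\sum_{i=0}^{b-1}f\left(\frac{i}{b}+\frac{j}{a}\right)+\beta_b\quad (j=0,1,\dots,a-1).$$ Then $$\alpha_b\sum_{i=0}^{b-1}\frac{i}{b}f\left(\frac{ia}{b}\right)+\alpha_a\sum_{j=0}^{a-1}\frac{j}{a}f\left(\frac{jb}{a}\right)=\alpha_a\alpha_b\sum_{k\in C_{a,b}}\left(\left(\frac{k}{ab}+1\right)f\left(\frac{k}{ab}+1\right)-\frac{k}{ab}f\left(\frac{k}{ab}\right)\right)$$ $$+\alpha_a\alpha_b\sum_{k=0}^{ab-1}\frac{k}{ab}f\left(\frac{k}{ab}\right)+\frac{\alpha_b\beta_a(b-1)}{2}+\frac{\alpha_a\beta_b(a-1)}{2}.$$ In particular, for a $1$-periodic function $f$, $$\alpha_b\sum_{i=0}^{b-1}\frac{i}{b}f\left(\frac{ia}{b}\right)+\alpha_a\sum_{j=0}^{a-1}\frac{j}{a}f\left(\frac{jb}{a}\right)=\alpha_a\alpha_b\sum_{k\in C_{a,b}}f\left(\frac{k}{ab}\right)+\alpha_a\alpha_b\sum_{k=0}^{ab-1}\frac{k}{ab}f\left(\frac{k}{ab}\right)+\frac{\alpha_b\beta_a(b-1)}{2}+\frac{\alpha_a\beta_b(a-1)}{2},$$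 and for $f(x)=\bar B_n(x)$, $$ab^ns_n(a,b)+ba^ns_n(b,a)=\sum_{i=0}^n\binom{n}{i}(ab)^iB_i\,S_{a,b}(n-i)+\sum_{i=0}^{n+1}\frac{n!\,(ab)^{n-i+1}B_iB_{n-i+1}}{i!\,(n-i+1)!}+\frac{nB_{n+1}}{n+1}.$$
   Context: For coprime positive integers $a,b$, $S_{a,b}=\{ua+vb:\ u,v\in\mathbb{Z}_{\ge 0}\}$ is the numerical semigroup generated by $a,b$, and $C_{a,b}:=\mathbb{Z}_{\ge 0}\setminus S_{a,b}$ is its (finite) complement. The Sylvester sums are $S_{a,b}(m):=\sum_{k\in C_{a,b}}k^m$. The Bernoulli polynomials are $B_n(x)=\sum_{i=0}^n\binom{n}{i}B_ix^{n-i}$ with Bernoulli numbers $B_n=B_n(0)$, and the Bernoulli functions are $\bar B_n(x):=B_n(x-[x])$, where $[x]$ is the integer part of $x$. The Apostol–Dedekind sums are $s_n(a,b):=\sum_{k=1}^{b-1}\frac{k}{b}\bar B_n\left(\frac{ka}{b}\right)$.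
   Formalization: The last formula as printed fails for n=1 and all even n (n=2, a=1, b=2: left side -1/6, right side -1/2). It is proved as printed for odd n≥3, and for every n≥0 with the factor (-1)^{n-i+1} inserted in the second sum. *)

theory Defs
  imports Complex_Main
begin

definition numerical_semigroup :: "nat \<Rightarrow> nat \<Rightarrow> nat set" where
  "numerical_semigroup a b = {u * a + v * b | u v. True}"

definition gaps :: "nat \<Rightarrow> nat \<Rightarrow> nat set" where
  "gaps a b = UNIV - numerical_semigroup a b"

definition sylvester_sum :: "nat \<Rightarrow> nat \<Rightarrow> nat \<Rightarrow> real" where
  "sylvester_sum a b m = (\<Sum>k\<in>gaps a b. real k ^ m)"

(* The recursion is the standard one, sum_{k <= m} (m+1 choose k) B_k = 0 for m >= 1,
   solved for the last term. It gives B_1 = -1/2, so that B_n = B_n(0) for all n. *)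
fun bernoulli :: "nat \<Rightarrow> real" where
  "bernoulli 0 = 1"
| "bernoulli (Suc n) = - (\<Sum>k\<le>n. real (n + 2 choose k) * bernoulli k) / real (n + 2)"

definition bernoulli_poly :: "nat \<Rightarrow> real \<Rightarrow> real" where
  "bernoulli_poly n x = (\<Sum>i\<le>n. real (n choose i) * bernoulli i * x ^ (n - i))"

definition bernoulli_fun :: "nat \<Rightarrow> real \<Rightarrow> real" where
  "bernoulli_fun n x = bernoulli_poly n (x - of_int \<lfloor>x\<rfloor>)"

definition apostol_dedekind :: "nat \<Rightarrow> nat \<Rightarrow> nat \<Rightarrow> real" where
  "apostol_dedekind n a b =
     (\<Sum>k = 1..b - 1. real k / real b * bernoulli_fun n (real k * real a / real b))"

end

(* The numbers ia + jb with i < b, j < a represent every residue modulo ab once; they are the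
   non-gaps below ab together with the shifts k + ab of the gaps k.  Inserting the functional
   equations turns the left-hand side into the sum of x f(x) over x = i/b + j/a = (ia + jb)/(ab),
   which this description splits into a sum over k < ab and a correction over the gaps.
   For the Bernoulli functions the functional equations are Raabe's multiplication formula, and
   the remaining sum over k < ab is evaluated by means of its exponential generating function. *)

theory Submission
  imports Defs "HOL-Computational_Algebra.Formal_Power_Series" "HOL-Number_Theory.Cong"
begin

unbundle fps_syntax

section \<open>Combinations of \<open>a\<close> and \<open>b\<close> modulo \<open>a * b\<close>,
  and the gaps\<close>

text \<open>Inverting \<open>a\<close> modulo \<open>b\<close> gives an \<open>i < b\<close> with
  \<open>i * a = m\<close> modulo \<open>b\<close>. Since \<open>i * a\<close> is at most
  \<open>a * b\<close>, hence at most \<open>m\<close>, the remainder is a nonnegative multiple of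
  \<open>b\<close>.\<close>

lemma exists_combination_residue:
  fixes a b m :: nat
  assumes "b > 0" "coprime a b" "m \<ge> a * b"
  obtains i j where "i < b" "m = i * a + j * b"
proof -
  obtain x where x: "[a * x = 1] (mod b)"
    using cong_solve_coprime_nat[OF assms(2)] by auto
  define i where "i = (x * m) mod b"
  have "[i * a = (x * m) * a] (mod b)"
    unfolding i_def by (intro cong_mult cong_refl) (simp add: cong_def)
  also have "(x * m) * a = (a * x) * m" by simp
  also have "[(a * x) * m = 1 * m] (mod b)"
    using x by (rule cong_mult) simp
  finally have c: "[i * a = m] (mod b)" by simp
  have ib: "i < b" unfolding i_def using assms(1) by simp
  then have "i * a \<le> b * a" by (intro mult_right_mono) auto
  with assms(3) have le: "i * a \<le> m" by (simp only: mult.commute[of b a])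
  then have "b dvd m - i * a" using c
    by (metis cong_altdef_nat' cong_def mod_eq_dvd_iff_nat)
  then obtain j where "m - i * a = b * j" by auto
  with le have "m = i * a + j * b" by (simp add: mult.commute)
  with ib that show thesis by blast
qed

lemma gaps_less:
  assumes "b > 0" "coprime a b" "k \<in> gaps a b"
  shows "k < a * b"
proof (rule ccontr)
  assume "\<not> k < a * b"
  then obtain i j where "k = i * a + j * b"
    using exists_combination_residue[OF assms(1,2), of k] by (metis not_less)
  then show False using assms(3) by (auto simp: gaps_def numerical_semigroup_def)
qed

lemma finite_gaps:
  assumes "b > 0" "coprime a b"
  shows "finite (gaps a b)"
  using gaps_less[OF assms] by (auto intro: finite_subset[of _ "{..<a * b}"])

text \<open>If \<open>j\<close> were at least \<open>a\<close>, the summand \<open>a * b\<close>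
  could be taken out of \<open>j * b\<close>, and the gap \<open>k\<close> itself would lie in the
  semigroup.\<close>

lemma gap_add_eq_combination:
  assumes "b > 0" "coprime a b" "k \<in> gaps a b"
  obtains i j where "i < b" "j < a" "k + a * b = i * a + j * b"
proof -
  obtain i j where ij: "i < b" "k + a * b = i * a + j * b"
    using exists_combination_residue[OF assms(1,2), of "k + a * b"] by auto
  have "j < a"
  proof (rule ccontr)
    assume "\<not> j < a"
    then have "j * b = (j - a) * b + a * b" by (simp add: diff_mult_distrib)
    with ij have "k = i * a + (j - a) * b" by simp
    then show False using assms(3) by (auto simp: gaps_def numerical_semigroup_def)
  qed
  with ij that show thesis by blast
qed

text \<open>A representation \<open>k = u * a + v * b\<close> would force \<open>i = u\<close>
  modulo \<open>b\<close>, hence \<open>i \<le> u\<close>, while \<open>j < a \<le> v + a\<close>.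
  Then \<open>u * a + (v + a) * b\<close> would be strictly larger than
  \<open>i * a + j * b\<close>.\<close>

lemma combination_minus_in_gaps:
  fixes a b i j :: nat
  assumes "coprime a b" "i < b" "j < a" "i * a + j * b = k + a * b"
  shows "k \<in> gaps a b"
proof -
  have False if uv: "k = u * a + v * b" for u v
  proof -
    have eq: "i * a + j * b = u * a + (v + a) * b"
      using assms(4) uv by (simp add: algebra_simps)
    then have "[i * a = u * a] (mod b)"
      by (metis cong_def mod_mult_self1)
    then have "[i = u] (mod b)"
      using assms(1) cong_mult_rcancel_nat coprime_commute by blast
    then have "i \<le> u"
      using assms(2) by (metis cong_def mod_less mod_less_eq_dividend)
    then have "i * a \<le> u * a" by simp
    moreover have "j * b < (v + a) * b" using assms(2,3) by simp
    ultimately show False using eq by linarith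
  qed
  then show ?thesis by (auto simp: gaps_def numerical_semigroup_def)
qed

lemma inj_on_combination:
  fixes a b :: nat
  assumes "coprime a b"
  shows "inj_on (\<lambda>(i, j). i * a + j * b) ({..<b} \<times> {..<a})"
proof (rule inj_onI, clarsimp)
  fix i j i' j' assume h: "i < b" "j < a" "i' < b" "j' < a" "i * a + j * b = i' * a + j' * b"
  then have "[i * a = i' * a] (mod b)"
    by (metis cong_def mod_mult_self1)
  then have "[i = i'] (mod b)"
    using assms cong_mult_rcancel_nat coprime_commute by blast
  with h have "i = i'" by (simp add: cong_def)
  with h show "i = i' \<and> j = j'" by simp
qed

lemma image_combination:
  fixes a b :: nat
  assumes "a > 0" "b > 0" "coprime a b"
  shows "(\<lambda>(i, j). i * a + j * b) ` ({..<b} \<times> {..<a})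
    = ({..<a * b} - gaps a b) \<union> (\<lambda>k. k + a * b) ` gaps a b" (is "?L = ?R")
proof (intro equalityI subsetI)
  fix x assume "x \<in> ?L"
  then obtain i j where ij: "i < b" "j < a" "x = i * a + j * b" by auto
  show "x \<in> ?R"
  proof (cases "x < a * b")
    case True
    moreover have "x \<notin> gaps a b" using ij by (auto simp: gaps_def numerical_semigroup_def)
    ultimately show ?thesis by simp
  next
    case False
    then have "x = (x - a * b) + a * b" by simp
    with combination_minus_in_gaps[OF assms(3) ij(1,2)] ij(3)
    have "x - a * b \<in> gaps a b" by simp
    with \<open>x = (x - a * b) + a * b\<close> show ?thesis by blast
  qed
next
  fix x assume "x \<in> ?R"
  then consider "x < a * b" "x \<notin> gaps a b" | k where "k \<in> gaps a b" "x = k + a * b" by auto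
  then show "x \<in> ?L"
  proof cases
    case 1
    then obtain u v where uv: "x = u * a + v * b" by (auto simp: gaps_def numerical_semigroup_def)
    then have "u * a < b * a" "v * b < a * b" using 1(1) by (simp_all only: mult.commute[of b a])
    then have "u < b" "v < a" by simp_all
    with uv show ?thesis by (auto intro!: image_eqI[of _ _ "(u, v)"])
  next
    case 2
    then obtain i j where "i < b" "j < a" "x = i * a + j * b"
      using gap_add_eq_combination[OF assms(2,3)] by metis
    then show ?thesis by (auto intro!: image_eqI[of _ _ "(i, j)"])
  qed
qed

text \<open>Here the semigroup enters the reciprocity law: compared with the sum over all
  \<open>k < a * b\<close>, each gap \<open>k\<close> is traded for
  \<open>k + a * b\<close>.\<close>

lemma sum_combination_eq:
  fixes F :: "nat \<Rightarrow> 'a :: ab_group_add"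
  assumes "a > 0" "b > 0" "coprime a b"
  shows "(\<Sum>i<b. \<Sum>j<a. F (i * a + j * b))
    = (\<Sum>k\<in>gaps a b. F (k + a * b) - F k) + (\<Sum>k<a * b. F k)"
proof -
  have fin: "finite (gaps a b)" by (rule finite_gaps[OF assms(2,3)])
  have sub: "gaps a b \<subseteq> {..<a * b}" using gaps_less[OF assms(2,3)] by auto
  have "(\<Sum>i<b. \<Sum>j<a. F (i * a + j * b)) = (\<Sum>p\<in>{..<b} \<times> {..<a}. F ((\<lambda>(i, j). i * a + j * b) p))"
    by (simp add: sum.cartesian_product case_prod_beta)
  also have "\<dots> = sum F ((\<lambda>(i, j). i * a + j * b) ` ({..<b} \<times> {..<a}))"
    by (simp add: sum.reindex[OF inj_on_combination[OF assms(3)]] comp_def)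
  also have "\<dots> = sum F ({..<a * b} - gaps a b) + sum F ((\<lambda>k. k + a * b) ` gaps a b)"
    unfolding image_combination[OF assms] by (rule sum.union_disjoint) (use fin in auto)
  also have "sum F ((\<lambda>k. k + a * b) ` gaps a b) = (\<Sum>k\<in>gaps a b. F (k + a * b))"
    by (subst sum.reindex) (auto simp: inj_on_def)
  also have "sum F ({..<a * b} - gaps a b) = sum F {..<a * b} - sum F (gaps a b)"
    by (rule sum_diff) (use sub in auto)
  finally show ?thesis by (simp add: sum_subtractf algebra_simps)
qed

section \<open>Reciprocity from the functional equations\<close>

lemma sum_of_nat_div:
  "n > 0 \<Longrightarrow> (\<Sum>i<n. of_nat i / of_nat n) = (of_nat n - 1 :: 'a :: field_char_0) / 2"
proof -
  assume n: "n > 0"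
  have "(\<Sum>i<n. of_nat i :: 'a) * 2 = of_nat n * (of_nat n - 1)"
    by (induction n) (simp_all add: algebra_simps)
  then have "(\<Sum>i<n. of_nat i :: 'a) = of_nat n * (of_nat n - 1) / 2"
    by (simp add: field_simps)
  then show ?thesis using n by (simp flip: sum_divide_distrib)
qed

text \<open>The values lie in an arbitrary field of characteristic zero, so real and complex
  \<open>f\<close> are both covered. The weights are therefore formed with \<open>of_nat\<close> in
  that field, the arguments of \<open>f\<close> in the reals.\<close>

lemma reciprocity_general:
  fixes f :: "real \<Rightarrow> 'a :: field_char_0"
  assumes "a > 0" "b > 0" "coprime a b"
    and fa: "\<forall>i<b. f (real i * real a / real b) =
                 \<alpha>a * (\<Sum>j<a. f (real i / real b + real j / real a)) + \<beta>a"
    and fb: "\<forall>j<a. f (real j * real b / real a) =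
                 \<alpha>b * (\<Sum>i<b. f (real i / real b + real j / real a)) + \<beta>b"
  shows "\<alpha>b * (\<Sum>i<b. of_nat i / of_nat b * f (real i * real a / real b))
          + \<alpha>a * (\<Sum>j<a. of_nat j / of_nat a * f (real j * real b / real a))
        = \<alpha>a * \<alpha>b * (\<Sum>k\<in>gaps a b.
              (of_nat k / of_nat (a * b) + 1) * f (real k / real (a * b) + 1)
              - of_nat k / of_nat (a * b) * f (real k / real (a * b)))
          + \<alpha>a * \<alpha>b * (\<Sum>k<a * b. of_nat k / of_nat (a * b) * f (real k / real (a * b)))
          + \<alpha>b * \<beta>a * (of_nat b - 1) / 2 + \<alpha>a * \<beta>b * (of_nat a - 1) / 2"
proof -
  define F where "F k = of_nat k / of_nat (a * b) * f (real k / real (a * b))" for k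
  define g where "g i j = f (real i / real b + real j / real a)" for i j
  have nz: "(of_nat a :: 'a) \<noteq> 0" "(of_nat b :: 'a) \<noteq> 0" "real a \<noteq> 0" "real b \<noteq> 0"
    using assms by auto
  \<comment> \<open>The constant \<open>\<beta>a\<close> is multiplied by the sum of all
    \<open>i / b\<close>, which is \<open>(b - 1) / 2\<close>.\<close>
  have 1: "\<alpha>b * (\<Sum>i<b. of_nat i / of_nat b * f (real i * real a / real b))
     = \<alpha>a * \<alpha>b * (\<Sum>i<b. \<Sum>j<a. of_nat i / of_nat b * g i j) + \<alpha>b * \<beta>a * (of_nat b - 1) / 2"
  proof -
    have "(\<Sum>i<b. of_nat i / of_nat b * f (real i * real a / real b))
      = (\<Sum>i<b. of_nat i / of_nat b * (\<alpha>a * (\<Sum>j<a. g i j) + \<beta>a))"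
      using fa by (intro sum.cong) (auto simp: g_def)
    also have "\<dots> = \<alpha>a * (\<Sum>i<b. \<Sum>j<a. of_nat i / of_nat b * g i j) + \<beta>a * (\<Sum>i<b. of_nat i / of_nat b)"
      by (simp add: sum_distrib_left sum.distrib distrib_left mult_ac)
    finally show ?thesis using sum_of_nat_div[OF assms(2), where 'a = 'a]
      by (simp add: algebra_simps)
  qed
  have 2: "\<alpha>a * (\<Sum>j<a. of_nat j / of_nat a * f (real j * real b / real a))
     = \<alpha>a * \<alpha>b * (\<Sum>i<b. \<Sum>j<a. of_nat j / of_nat a * g i j) + \<alpha>a * \<beta>b * (of_nat a - 1) / 2"
  proof -
    have "(\<Sum>j<a. of_nat j / of_nat a * f (real j * real b / real a))
      = (\<Sum>j<a. of_nat j / of_nat a * (\<alpha>b * (\<Sum>i<b. g i j) + \<beta>b))"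
      using fb by (intro sum.cong) (auto simp: g_def)
    also have "\<dots> = \<alpha>b * (\<Sum>j<a. \<Sum>i<b. of_nat j / of_nat a * g i j) + \<beta>b * (\<Sum>j<a. of_nat j / of_nat a)"
      by (simp add: sum_distrib_left sum.distrib distrib_left mult_ac)
    also have "(\<Sum>j<a. \<Sum>i<b. of_nat j / of_nat a * g i j) = (\<Sum>i<b. \<Sum>j<a. of_nat j / of_nat a * g i j)"
      by (rule sum.swap)
    finally show ?thesis using sum_of_nat_div[OF assms(1), where 'a = 'a]
      by (simp add: algebra_simps)
  qed
  \<comment> \<open>The two weights add up to the point at which \<open>f\<close> is evaluated, so
    the two double sums merge into one sum of \<open>x * f x\<close>.\<close>
  have 3: "of_nat i / of_nat b * g i j + of_nat j / of_nat a * g i j = F (i * a + j * b)" for i j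
  proof -
    have "real (i * a + j * b) / real (a * b) = real i / real b + real j / real a"
      "(of_nat (i * a + j * b) / of_nat (a * b) :: 'a) = of_nat i / of_nat b + of_nat j / of_nat a"
      using nz by (simp_all add: field_simps)
    then show ?thesis unfolding F_def g_def by (simp only: distrib_right)
  qed
  have 4: "F (k + a * b) = (of_nat k / of_nat (a * b) + 1) * f (real k / real (a * b) + 1)" for k
  proof -
    have "real (k + a * b) / real (a * b) = real k / real (a * b) + 1"
      "(of_nat (k + a * b) / of_nat (a * b) :: 'a) = of_nat k / of_nat (a * b) + 1"
      using nz by (simp_all add: field_simps)
    then show ?thesis unfolding F_def by (simp only:)
  qed
  have "(\<Sum>i<b. \<Sum>j<a. of_nat i / of_nat b * g i j) + (\<Sum>i<b. \<Sum>j<a. of_nat j / of_nat a * g i j)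
    = (\<Sum>k\<in>gaps a b. F (k + a * b) - F k) + (\<Sum>k<a * b. F k)"
    unfolding sum_combination_eq[OF assms(1-3), symmetric] by (simp only: 3 flip: sum.distrib)
  then have "\<alpha>a * \<alpha>b * (\<Sum>i<b. \<Sum>j<a. of_nat i / of_nat b * g i j)
      + \<alpha>a * \<alpha>b * (\<Sum>i<b. \<Sum>j<a. of_nat j / of_nat a * g i j)
    = \<alpha>a * \<alpha>b * (\<Sum>k\<in>gaps a b. F (k + a * b) - F k) + \<alpha>a * \<alpha>b * (\<Sum>k<a * b. F k)"
    by (simp only: flip: distrib_left)
  then show ?thesis unfolding 1 2 unfolding 4 unfolding F_def by (simp only: ac_simps)
qed

lemma reciprocity_periodic:
  fixes f :: "real \<Rightarrow> 'a :: field_char_0"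
  assumes "a > 0" "b > 0" "coprime a b"
    and "\<forall>i<b. f (real i * real a / real b) =
                 \<alpha>a * (\<Sum>j<a. f (real i / real b + real j / real a)) + \<beta>a"
    and "\<forall>j<a. f (real j * real b / real a) =
                 \<alpha>b * (\<Sum>i<b. f (real i / real b + real j / real a)) + \<beta>b"
    and per: "\<forall>x. f (x + 1) = f x"
  shows "\<alpha>b * (\<Sum>i<b. of_nat i / of_nat b * f (real i * real a / real b))
          + \<alpha>a * (\<Sum>j<a. of_nat j / of_nat a * f (real j * real b / real a))
        = \<alpha>a * \<alpha>b * (\<Sum>k\<in>gaps a b. f (real k / real (a * b)))
          + \<alpha>a * \<alpha>b * (\<Sum>k<a * b. of_nat k / of_nat (a * b) * f (real k / real (a * b)))
          + \<alpha>b * \<beta>a * (of_nat b - 1) / 2 + \<alpha>a * \<beta>b * (of_nat a - 1) / 2"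
proof -
  have "(of_nat k / of_nat (a * b) + 1) * f (real k / real (a * b) + 1)
      - of_nat k / of_nat (a * b) * f (real k / real (a * b)) = f (real k / real (a * b))" for k
    by (simp only: per[rule_format] distrib_right mult_1_left add_diff_cancel_left')
  then show ?thesis using reciprocity_general[OF assms(1-5)] by (simp only:)
qed

section \<open>Generating functions of the Bernoulli numbers and polynomials\<close>

lemma sum_choose_bernoulli:
  "(\<Sum>i<n. real (n choose i) * bernoulli i) = (if n = 1 then 1 else 0)"
proof (cases "n \<le> 1")
  case True
  then have "n = 0 \<or> n = 1" by auto
  then show ?thesis by auto
next
  case False
  then obtain m where m: "n = Suc (Suc m)" by (metis One_nat_def le_Suc_eq not_less_eq_eq old.nat.exhaust)
  have "(\<Sum>i<n. real (n choose i) * bernoulli i)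
    = (\<Sum>i\<le>m. real (n choose i) * bernoulli i) + real (n choose Suc m) * bernoulli (Suc m)"
    unfolding m by (simp only: lessThan_Suc_atMost sum.atMost_Suc)
  \<comment> \<open>With \<open>n = m + 2\<close> this binomial is the denominator in the recursion
    for \<open>bernoulli (Suc m)\<close>.\<close>
  also have "real (n choose Suc m) = real (m + 2)"
    unfolding m using binomial_symmetric[of "Suc m" "Suc (Suc m)"] by simp
  also have "(\<Sum>i\<le>m. real (n choose i) * bernoulli i) + real (m + 2) * bernoulli (Suc m) = 0"
    unfolding m by (simp add: field_simps del: of_nat_Suc of_nat_add)
  finally show ?thesis using m by simp
qed

text \<open>The series \<open>ct / (e^(ct) - 1)\<close>.\<close>
definition bernoulli_fps :: "real \<Rightarrow> real fps" where
  "bernoulli_fps c = Abs_fps (\<lambda>n. bernoulli n * c ^ n / fact n)"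

lemma bernoulli_fps_nth [simp]: "bernoulli_fps c $ n = bernoulli n * c ^ n / fact n"
  by (simp add: bernoulli_fps_def)

text \<open>Stated as a product because \<open>fps_exp c - 1\<close> has constant term 0 and thus no
  inverse among power series. Later proofs cancel this factor, which is nonzero for nonzero
  \<open>c\<close>.\<close>

lemma bernoulli_fps_mult: "bernoulli_fps c * (fps_exp c - 1) = fps_const c * fps_X"
proof (rule fps_ext)
  fix n
  have "(bernoulli_fps c * (fps_exp c - 1)) $ n
    = (\<Sum>i\<le>n. bernoulli i * c ^ i / fact i * ((fps_exp c - 1) $ (n - i)))"
    by (simp add: fps_mult_nth atLeast0AtMost)
  \<comment> \<open>The term \<open>i = n\<close> drops out since \<open>fps_exp c - 1\<close> has
    constant term 0.\<close>
  also have "\<dots> = (\<Sum>i<n. bernoulli i * c ^ i / fact i * ((fps_exp c - 1) $ (n - i)))"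
    by (cases n) (simp_all add: lessThan_Suc_atMost mult_ac)
  also have "\<dots> = (\<Sum>i<n. c ^ n / fact n * (real (n choose i) * bernoulli i))"
  proof (rule sum.cong)
    fix i assume "i \<in> {..<n}"
    then have i: "i < n" by simp
    then have "c ^ n = c ^ i * c ^ (n - i)" by (simp flip: power_add)
    with i show "bernoulli i * c ^ i / fact i * ((fps_exp c - 1) $ (n - i))
        = c ^ n / fact n * (real (n choose i) * bernoulli i)"
      by (simp add: binomial_fact field_simps)
  qed simp
  also have "\<dots> = c ^ n / fact n * (if n = 1 then 1 else 0)"
    by (simp only: sum_choose_bernoulli flip: sum_distrib_left)
  also have "\<dots> = (fps_const c * fps_X) $ n" by (simp add: fps_X_def)
  finally show "(bernoulli_fps c * (fps_exp c - 1)) $ n = (fps_const c * fps_X) $ n" .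
qed

text \<open>The classical generating function of the Bernoulli polynomials with the variable scaled
  by \<open>c\<close>. The multiplication formula compares the scales 1 and
  \<open>1 / a\<close>.\<close>

lemma bernoulli_fps_mult_exp:
  "bernoulli_fps c * fps_exp (c * x) = Abs_fps (\<lambda>n. bernoulli_poly n x * c ^ n / fact n)"
proof (rule fps_ext)
  fix n
  have "bernoulli i * c ^ i / fact i * ((c * x) ^ (n - i) / fact (n - i))
      = real (n choose i) * bernoulli i * x ^ (n - i) * (c ^ n / fact n)" if "i \<le> n" for i
  proof -
    from that have "c ^ n = c ^ i * c ^ (n - i)" by (simp flip: power_add)
    with that show ?thesis by (simp add: binomial_fact field_simps power_mult_distrib)
  qed
  then have "(\<Sum>i\<le>n. bernoulli i * c ^ i / fact i * ((c * x) ^ (n - i) / fact (n - i)))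
      = (\<Sum>i\<le>n. real (n choose i) * bernoulli i * x ^ (n - i) * (c ^ n / fact n))"
    by (intro sum.cong) simp_all
  then show "(bernoulli_fps c * fps_exp (c * x)) $ n
      = Abs_fps (\<lambda>n. bernoulli_poly n x * c ^ n / fact n) $ n"
    by (simp add: fps_mult_nth atLeast0AtMost bernoulli_poly_def sum_distrib_right sum_divide_distrib)
qed

lemma fps_exp_minus_one_nonzero: "c \<noteq> 0 \<Longrightarrow> fps_exp c - 1 \<noteq> (0 :: real fps)"
  by (metis fps_exp_0 fps_exp_eq_iff right_minus_eq)

text \<open>Expanding \<open>-t / (e^(-t) - 1)\<close> by \<open>e^t\<close> gives
  \<open>t e^t / (e^t - 1)\<close>. The coefficients of this series carry the signs that appear in
  the final formula.\<close>

lemma bernoulli_fps_minus_one_mult: "bernoulli_fps (-1) * (fps_exp 1 - 1) = fps_X * fps_exp 1"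
proof -
  have e: "fps_exp (-1) * fps_exp (1 :: real) = 1" by (simp flip: fps_exp_add_mult)
  have "bernoulli_fps (-1) * (fps_exp 1 - 1)
     = - (bernoulli_fps (-1) * (fps_exp (-1) - 1) * fps_exp 1)
        + bernoulli_fps (-1) * (fps_exp (-1) * fps_exp 1 - 1)"
    by (simp add: algebra_simps)
  also have "\<dots> = fps_X * fps_exp 1"
    unfolding bernoulli_fps_mult e by (simp flip: fps_const_neg)
  finally show ?thesis .
qed

text \<open>The series \<open>t e^t / (e^t - 1)\<close> exceeds \<open>t / (e^t - 1)\<close> by
  exactly \<open>t\<close>, so replacing \<open>t\<close> by \<open>-t\<close> changes only the
  coefficient of index 1.\<close>

lemma bernoulli_odd_eq_0:
  assumes "odd n" "n \<noteq> 1"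
  shows "bernoulli n = 0"
proof -
  have "bernoulli_fps (-1) * (fps_exp 1 - 1) = (bernoulli_fps 1 + fps_X) * (fps_exp 1 - 1)"
    unfolding bernoulli_fps_minus_one_mult distrib_right bernoulli_fps_mult by (simp add: algebra_simps)
  then have "bernoulli_fps (-1) = bernoulli_fps 1 + fps_X"
    using fps_exp_minus_one_nonzero[of 1] by simp
  then have "bernoulli_fps (-1) $ n = (bernoulli_fps 1 + fps_X) $ n" by simp
  with assms show ?thesis by (simp add: fps_X_def)
qed

section \<open>Raabe's multiplication formula, and geometric sums of exponentials\<close>

lemma sum_fps_exp_mult:
  fixes u :: real
  shows "(\<Sum>k<N. fps_exp (real k * u)) * (fps_exp u - 1) = fps_exp (real N * u) - 1"
  by (induction N) (simp_all add: algebra_simps fps_exp_add_mult)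

text \<open>The closed form of the sum of \<open>k q^k\<close> for \<open>q = e^(ut)\<close>,
  cleared of its denominator \<open>(q - 1)^2\<close>.\<close>

lemma sum_weighted_fps_exp_mult:
  fixes u :: real
  shows "(\<Sum>k<N. of_nat k * fps_exp (real k * u)) * (fps_exp u - 1)\<^sup>2
    = of_nat N * fps_exp (real N * u) * (fps_exp u - 1) - fps_exp u * (fps_exp (real N * u) - 1)"
  by (induction N) (simp_all add: algebra_simps fps_exp_add_mult power2_eq_square)

text \<open>Summing \<open>t e^((y + j/a) t) / (e^t - 1)\<close> over \<open>j\<close> is a
  geometric sum with ratio \<open>e^(t/a)\<close>. It replaces the denominator by
  \<open>e^(t/a) - 1\<close>, which leaves \<open>a\<close> times the generating function at
  \<open>t / a\<close>.\<close>

lemma bernoulli_poly_multiplication: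
  assumes "a > 0"
  shows "real a * bernoulli_poly n (real a * y) = real a ^ n * (\<Sum>j<a. bernoulli_poly n (y + real j / real a))"
proof -
  define u where "u = 1 / real a"
  have u: "u \<noteq> 0" "real a * u = 1" using assms by (auto simp: u_def)
  have "(\<Sum>j<a. bernoulli_fps 1 * fps_exp (1 * (y + real j / real a))) * (fps_exp u - 1)
     = bernoulli_fps 1 * fps_exp y * ((\<Sum>j<a. fps_exp (real j * u)) * (fps_exp u - 1))"
    by (simp add: u_def fps_exp_add_mult sum_distrib_left sum_distrib_right mult_ac)
  also have "\<dots> = fps_X * fps_exp y"
    unfolding sum_fps_exp_mult u(2) using bernoulli_fps_mult[of 1] by (simp add: mult_ac)
  \<comment> \<open>Since \<open>a * u = 1\<close>, both \<open>t\<close> and \<open>e^(yt)\<close>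
    can be rewritten in the scaled variable \<open>u t\<close>.\<close>
  also have "\<dots> = of_nat a * (bernoulli_fps u * (fps_exp u - 1)) * fps_exp (u * (real a * y))"
  proof -
    have "of_nat a * fps_const u = fps_const 1"
      using u(2) by (simp flip: fps_of_nat)
    then have "of_nat a * (fps_const u * fps_X) = fps_X" by (simp flip: mult.assoc)
    moreover have "u * (real a * y) = (real a * u) * y" by (simp only: mult_ac)
    then have "u * (real a * y) = y" by (simp only: u(2) mult_1_left)
    ultimately show ?thesis by (simp only: bernoulli_fps_mult)
  qed
  finally have "(\<Sum>j<a. bernoulli_fps 1 * fps_exp (1 * (y + real j / real a))) * (fps_exp u - 1)
     = of_nat a * (bernoulli_fps u * fps_exp (u * (real a * y))) * (fps_exp u - 1)"
    by (simp only: mult_ac)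
  then have "(\<Sum>j<a. bernoulli_fps 1 * fps_exp (1 * (y + real j / real a)))
     = of_nat a * (bernoulli_fps u * fps_exp (u * (real a * y)))"
    using fps_exp_minus_one_nonzero[OF u(1)] by simp
  then have "(\<Sum>j<a. bernoulli_fps 1 * fps_exp (1 * (y + real j / real a))) $ n
     = (fps_const (real a) * (bernoulli_fps u * fps_exp (u * (real a * y)))) $ n"
    by (simp add: fps_of_nat)
  then have "(\<Sum>j<a. bernoulli_poly n (y + real j / real a)) / fact n
     = real a * bernoulli_poly n (real a * y) * u ^ n / fact n"
    unfolding bernoulli_fps_mult_exp by (simp add: fps_sum_nth sum_divide_distrib)
  then show ?thesis using assms by (simp add: u_def field_simps)
qed

lemma bernoulli_fun_add_of_int: "bernoulli_fun n (x + of_int m) = bernoulli_fun n x"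
  by (simp add: bernoulli_fun_def)

lemma bernoulli_fun_eq_poly: "0 \<le> x \<Longrightarrow> x < 1 \<Longrightarrow> bernoulli_fun n x = bernoulli_poly n x"
  using floor_eq_iff[of x 0] by (simp add: bernoulli_fun_def)

text \<open>Both sides of the multiplication formula are \<open>1/a\<close>-periodic in \<open>x\<close>, which reduces it
  to \<open>0 \<le> x < 1/a\<close>, where only polynomial values occur.\<close>
lemma bernoulli_fun_multiplication:
  assumes "a > 0"
  shows "real a * bernoulli_fun n (real a * x) = real a ^ n * (\<Sum>j<a. bernoulli_fun n (x + real j / real a))"
proof -
  define h where "h y = (\<Sum>j<a. bernoulli_fun n (y + real j / real a))" for y
  have step: "h (y + 1 / real a) = h y" for y
  proof -
    \<comment> \<open>A sum of \<open>a + 1\<close> consecutive terms is split off at its first and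
      at its last term; these two have arguments that differ by 1.\<close>
    have "h (y + 1 / real a) + bernoulli_fun n y = (\<Sum>j<Suc a. bernoulli_fun n (y + real j / real a))"
      unfolding sum.lessThan_Suc_shift h_def by (simp add: add_divide_distrib add_ac)
    also have "\<dots> = h y + bernoulli_fun n (y + 1)" using assms by (simp add: h_def)
    also have "bernoulli_fun n (y + 1) = bernoulli_fun n y"
      using bernoulli_fun_add_of_int[of n y 1] by simp
    finally show ?thesis by simp
  qed
  have shift: "h (y + of_int m / real a) = h y" for y m
  proof (induction m rule: int_induct[of _ 0])
    case (step1 i)
    have "y + of_int (i + 1) / real a = (y + of_int i / real a) + 1 / real a"
      by (simp add: add_divide_distrib)
    then show ?case using step1 step by metis
  next
    case (step2 i)
    have "y + of_int i / real a = (y + of_int (i - 1) / real a) + 1 / real a"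
      by (simp add: diff_divide_distrib)
    then show ?case using step2 step by metis
  qed simp
  \<comment> \<open>Taking away \<open>m\<close> steps of length \<open>1 / a\<close> moves
    \<open>x\<close> to a point \<open>y\<close> with \<open>0 \<le> a * y < 1\<close>.\<close>
  define m where "m = \<lfloor>real a * x\<rfloor>"
  define y where "y = x - of_int m / real a"
  have x: "x = y + of_int m / real a" by (simp add: y_def)
  have ay: "real a * y = real a * x - of_int m" using assms by (simp add: y_def field_simps)
  have y: "0 \<le> real a * y" "real a * y < 1" unfolding ay m_def by linarith+
  have y0: "0 \<le> y" using y(1) assms by (simp add: zero_le_mult_iff)
  have "h x = h y" unfolding x by (rule shift)
  also have "h y = (\<Sum>j<a. bernoulli_poly n (y + real j / real a))"
    unfolding h_def
  proof (intro sum.cong bernoulli_fun_eq_poly)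
    fix j assume "j \<in> {..<a}"
    then have "real j + 1 \<le> real a" by auto
    then have "real a * y + real j < real a" using y(2) by linarith
    then show "y + real j / real a < 1" using assms by (simp add: field_simps)
  qed (use y0 in auto)
  finally have "real a ^ n * h x = real a * bernoulli_poly n (real a * y)"
    by (simp add: bernoulli_poly_multiplication[OF assms])
  also have "bernoulli_poly n (real a * y) = bernoulli_fun n (real a * y)"
    by (rule bernoulli_fun_eq_poly[symmetric]) (use y in auto)
  also have "\<dots> = bernoulli_fun n (real a * x)"
    using bernoulli_fun_add_of_int[of n "real a * y" m] by (simp add: ay)
  finally show ?thesis by (simp add: h_def)
qed

section \<open>The sum of \<open>x B_n(x)\<close> over the points \<open>x = k / N\<close>\<close>

text \<open>The product rule applied to \<open>bernoulli_fps_mult\<close>. The derivative is what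
  accounts for the double pole \<open>q / (q - 1)^2\<close> of the weighted geometric sum.\<close>

lemma fps_deriv_bernoulli_fps_mult:
  "fps_deriv (bernoulli_fps c) * (fps_exp c - 1)
    = fps_const c - bernoulli_fps c * (fps_const c * fps_exp c)"
proof -
  have "fps_deriv (bernoulli_fps c * (fps_exp c - 1)) = fps_deriv (fps_const c * fps_X)"
    by (simp only: bernoulli_fps_mult)
  then show ?thesis by (simp add: algebra_simps)
qed

text \<open>With \<open>q = e^(t/N)\<close>, this is
  \<open>t/(e^t - 1) \<Sum> k q^k = t e^t N/((e^t - 1)(q - 1)) - t q/(q - 1)^2\<close>, multiplied by \<open>t/N\<close> to
  stay within power series.\<close>
lemma weighted_bernoulli_fps_identity:
  fixes N :: nat
  assumes "N > 0"
  defines "u \<equiv> 1 / real N"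
  shows "fps_X * (bernoulli_fps 1 * (fps_const u * (\<Sum>k<N. of_nat k * fps_exp (real k * u))))
    = fps_const (real N) * (bernoulli_fps u * bernoulli_fps (-1)
        + fps_X * fps_deriv (bernoulli_fps u) - bernoulli_fps u)"
proof -
  have u: "u \<noteq> 0" "real N * u = 1" using assms by auto
  define D where "D = fps_exp u - (1 :: real fps)"
  define Q where "Q = fps_exp (1 :: real) - 1"
  define S where "S = (\<Sum>k<N. of_nat k * fps_exp (real k * u))"
  define c where "c = fps_const u"
  define M where "M = fps_const (real N)"
  have Mc: "M * c = 1" using u(2) by (simp add: M_def c_def)
  have S: "S * D\<^sup>2 = M * (Q + 1) * D - (D + 1) * Q"
    using sum_weighted_fps_exp_mult[where N = N and u = u] unfolding u(2)
    by (simp add: S_def D_def Q_def M_def fps_of_nat)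
  have b1: "bernoulli_fps 1 * Q = fps_X" using bernoulli_fps_mult[of 1] by (simp add: Q_def)
  have bm: "bernoulli_fps (-1) * Q = fps_X * (Q + 1)"
    using bernoulli_fps_minus_one_mult by (simp add: Q_def)
  have bu: "bernoulli_fps u * D = c * fps_X" using bernoulli_fps_mult[of u] by (simp add: D_def c_def)
  have bd: "fps_deriv (bernoulli_fps u) * D = c - bernoulli_fps u * (c * (D + 1))"
    using fps_deriv_bernoulli_fps_mult[of u] by (simp add: D_def c_def)
  \<comment> \<open>The previous equation still contains \<open>bernoulli_fps u\<close>; a second
    factor \<open>D\<close> removes it through \<open>bu\<close>.\<close>
  have bd2: "fps_deriv (bernoulli_fps u) * D\<^sup>2 = c * D - c * c * fps_X * (D + 1)"
  proof -
    have "fps_deriv (bernoulli_fps u) * D\<^sup>2 = (c - bernoulli_fps u * (c * (D + 1))) * D"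
      unfolding bd[symmetric] by (simp add: power2_eq_square mult_ac)
    also have "\<dots> = c * D - (bernoulli_fps u * D) * (c * (D + 1))" by (simp add: algebra_simps)
    finally show ?thesis unfolding bu by (simp add: algebra_simps)
  qed
  \<comment> \<open>Both sides are compared after multiplication by the common denominator
    \<open>D^2 * Q\<close>, which is cancelled at the end.\<close>
  have "fps_X * (bernoulli_fps 1 * (c * S)) * (D\<^sup>2 * Q)
     = fps_X * c * (bernoulli_fps 1 * Q) * (S * D\<^sup>2)" by (simp add: mult_ac)
  also have "\<dots> = fps_X\<^sup>2 * (M * c) * (Q + 1) * D - fps_X\<^sup>2 * c * (D + 1) * Q"
    unfolding S b1 by (simp add: algebra_simps power2_eq_square)
  finally have L: "fps_X * (bernoulli_fps 1 * (c * S)) * (D\<^sup>2 * Q)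
     = fps_X\<^sup>2 * (Q + 1) * D - fps_X\<^sup>2 * c * (D + 1) * Q" by (simp add: Mc)
  have "M * (bernoulli_fps u * bernoulli_fps (-1)
        + fps_X * fps_deriv (bernoulli_fps u) - bernoulli_fps u) * (D\<^sup>2 * Q)
     = M * ((bernoulli_fps u * D) * (bernoulli_fps (-1) * Q) * D
        + fps_X * (fps_deriv (bernoulli_fps u) * D\<^sup>2) * Q - (bernoulli_fps u * D) * D * Q)"
    by (simp add: algebra_simps power2_eq_square)
  also have "\<dots> = (M * c) * (fps_X\<^sup>2 * (Q + 1) * D - fps_X\<^sup>2 * c * (D + 1) * Q)"
    unfolding bu bm bd2 by (simp add: algebra_simps power2_eq_square)
  finally have "fps_X * (bernoulli_fps 1 * (c * S)) * (D\<^sup>2 * Q)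
     = M * (bernoulli_fps u * bernoulli_fps (-1)
        + fps_X * fps_deriv (bernoulli_fps u) - bernoulli_fps u) * (D\<^sup>2 * Q)"
    by (simp add: L Mc)
  moreover have "D\<^sup>2 * Q \<noteq> 0"
    using fps_exp_minus_one_nonzero[OF u(1)] fps_exp_minus_one_nonzero[of 1]
    by (simp add: D_def Q_def)
  ultimately show ?thesis by (simp add: S_def c_def M_def)
qed

lemma sum_weighted_bernoulli_poly:
  assumes "N > 0"
  shows "real N ^ n * (\<Sum>k<N. real k / real N * bernoulli_poly n (real k / real N))
    = (\<Sum>i\<le>n + 1. (- 1) ^ (n + 1 - i) * fact n * real N ^ (n + 1 - i)
          * bernoulli i * bernoulli (n + 1 - i) / (fact i * fact (n + 1 - i)))
      + real n * bernoulli (n + 1) / real (n + 1)"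
proof -
  define u where "u = 1 / real N"
  have u: "real N * u = 1" using assms by (simp add: u_def)
  have NU: "real N ^ k * u ^ k = 1" for k using u by (metis power_mult_distrib power_one)
  define L where "L = bernoulli_fps 1 * (fps_const u * (\<Sum>k<N. of_nat k * fps_exp (real k * u)))"
  have "L = (\<Sum>k<N. fps_const (real k / real N) * (bernoulli_fps 1 * fps_exp (1 * (real k / real N))))"
    unfolding L_def sum_distrib_left
  proof (rule sum.cong)
    fix k
    have "fps_const (real k / real N) = fps_const u * of_nat k"
      by (simp add: u_def flip: fps_of_nat)
    then show "bernoulli_fps 1 * (fps_const u * (of_nat k * fps_exp (real k * u)))
        = fps_const (real k / real N) * (bernoulli_fps 1 * fps_exp (1 * (real k / real N)))"
      by (simp add: u_def mult_ac)
  qed simp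
  then have Ln: "L $ n = (\<Sum>k<N. real k / real N * bernoulli_poly n (real k / real N)) / fact n"
    unfolding bernoulli_fps_mult_exp by (simp add: fps_sum_nth sum_divide_distrib)
  \<comment> \<open>The index is \<open>n + 1\<close> because the identity carries an extra factor
    \<open>t\<close>. There the derivative contributes \<open>n + 1\<close> times and the last term
    \<open>-1\<close> times the same number, hence the factor \<open>n\<close> in the
    result.\<close>
  have "(fps_X * L) $ (n + 1) = (fps_const (real N) * (bernoulli_fps u * bernoulli_fps (-1)
        + fps_X * fps_deriv (bernoulli_fps u) - bernoulli_fps u)) $ (n + 1)"
    using weighted_bernoulli_fps_identity[OF assms] unfolding L_def u_def by simp
  then have Lc: "L $ n = real N * ((\<Sum>i\<le>n + 1. bernoulli i * u ^ i / fact i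
        * (bernoulli (n + 1 - i) * (-1) ^ (n + 1 - i) / fact (n + 1 - i)))
      + real (n + 1) * (bernoulli (n + 1) * u ^ (n + 1) / fact (n + 1))
      - bernoulli (n + 1) * u ^ (n + 1) / fact (n + 1))"
    by (simp add: fps_mult_nth[of "bernoulli_fps u"] atLeast0AtMost del: sum.atMost_Suc fact_Suc power_Suc)
  \<comment> \<open>Free variables stand for the convolution sum, the Bernoulli number, the power of
    \<open>u\<close> and the factorial, so that the rearrangement leaves them intact.\<close>
  have expand: "real N ^ n * (fact n * (real N * (T + real (n + 1) * (B * U / F) - B * U / F)))
      = fact n * real N ^ (n + 1) * T + (real N ^ (n + 1) * U) * (real n * B * (fact n / F))"
    for T B U F :: real by (simp add: algebra_simps add_divide_distrib)
  have "real N ^ n * (\<Sum>k<N. real k / real N * bernoulli_poly n (real k / real N))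
      = real N ^ n * (fact n * L $ n)"
    unfolding Ln by simp
  also have "\<dots> = fact n * real N ^ (n + 1) * (\<Sum>i\<le>n + 1. bernoulli i * u ^ i / fact i
        * (bernoulli (n + 1 - i) * (-1) ^ (n + 1 - i) / fact (n + 1 - i)))
      + (real N ^ (n + 1) * u ^ (n + 1)) * (real n * bernoulli (n + 1) * (fact n / fact (n + 1)))"
    unfolding Lc by (rule expand)
  also have "fact n / fact (n + 1) = 1 / real (n + 1)" by simp
  also have "fact n * real N ^ (n + 1) * (\<Sum>i\<le>n + 1. bernoulli i * u ^ i / fact i
        * (bernoulli (n + 1 - i) * (-1) ^ (n + 1 - i) / fact (n + 1 - i)))
     = (\<Sum>i\<le>n + 1. (- 1) ^ (n + 1 - i) * fact n * real N ^ (n + 1 - i)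
          * bernoulli i * bernoulli (n + 1 - i) / (fact i * fact (n + 1 - i)))"
    unfolding sum_distrib_left
  proof (rule sum.cong)
    fix i assume "i \<in> {..n + 1}"
    then have "real N ^ (n + 1) = real N ^ (n + 1 - i) * real N ^ i" by (simp flip: power_add)
    then have NN: "real N ^ (n + 1) * u ^ i = real N ^ (n + 1 - i)" using NU[of i] by (simp add: mult_ac)
    show "fact n * real N ^ (n + 1) * (bernoulli i * u ^ i / fact i
        * (bernoulli (n + 1 - i) * (-1) ^ (n + 1 - i) / fact (n + 1 - i)))
      = (- 1) ^ (n + 1 - i) * fact n * real N ^ (n + 1 - i)
          * bernoulli i * bernoulli (n + 1 - i) / (fact i * fact (n + 1 - i))"
      unfolding NN[symmetric] by (simp add: mult_ac)
  qed simp
  finally show ?thesis unfolding NU by simp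
qed

section \<open>Reciprocity for the Apostol-Dedekind sums\<close>

lemma apostol_dedekind_eq:
  "apostol_dedekind n a b = (\<Sum>i<b. real i / real b * bernoulli_fun n (real i * real a / real b))"
  unfolding apostol_dedekind_def by (rule sum.mono_neutral_left) auto

text \<open>Gaps lie below \<open>a * b\<close>, so each argument is in the unit interval and the
  Bernoulli function is the polynomial there. Expanding it and exchanging the sums produces the
  Sylvester sums.\<close>

lemma sum_gaps_bernoulli_fun:
  assumes "a > 0" "b > 0" "coprime a b"
  shows "real (a * b) ^ n * (\<Sum>k\<in>gaps a b. bernoulli_fun n (real k / real (a * b)))
    = (\<Sum>i\<le>n. real (n choose i) * real (a * b) ^ i * bernoulli i * sylvester_sum a b (n - i))"
proof -
  define N where "N = real (a * b)"
  have N: "N > 0" using assms by (simp add: N_def)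
  have "N ^ n * bernoulli_fun n (real k / N)
      = (\<Sum>i\<le>n. real (n choose i) * N ^ i * bernoulli i * real k ^ (n - i))" if "k \<in> gaps a b" for k
  proof -
    have "real k < N" using gaps_less[OF assms(2,3) that] by (simp add: N_def del: of_nat_mult)
    then have poly: "bernoulli_fun n (real k / N) = bernoulli_poly n (real k / N)"
      using N by (intro bernoulli_fun_eq_poly) auto
    have summand: "N ^ n * (real (n choose i) * bernoulli i * (real k / N) ^ (n - i))
        = real (n choose i) * N ^ i * bernoulli i * real k ^ (n - i)" if "i \<le> n" for i
    proof -
      have "N ^ n = N ^ i * N ^ (n - i)" using that by (simp flip: power_add)
      then show ?thesis using N by (simp add: power_divide)
    qed
    show ?thesis
      unfolding poly bernoulli_poly_def sum_distrib_left
      by (intro sum.cong refl) (simp only: summand atMost_iff)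
  qed
  then have "N ^ n * (\<Sum>k\<in>gaps a b. bernoulli_fun n (real k / N))
     = (\<Sum>k\<in>gaps a b. \<Sum>i\<le>n. real (n choose i) * N ^ i * bernoulli i * real k ^ (n - i))"
    by (simp add: sum_distrib_left)
  also have "\<dots> = (\<Sum>i\<le>n. \<Sum>k\<in>gaps a b. real (n choose i) * N ^ i * bernoulli i * real k ^ (n - i))"
    by (rule sum.swap)
  finally show ?thesis by (simp add: sylvester_sum_def sum_distrib_left N_def)
qed

lemma apostol_dedekind_reciprocity:
  assumes "a > 0" "b > 0" "coprime a b"
  shows "real a * real b ^ n * apostol_dedekind n a b + real b * real a ^ n * apostol_dedekind n b a
        = (\<Sum>i\<le>n. real (n choose i) * real (a * b) ^ i * bernoulli i * sylvester_sum a b (n - i))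
          + (\<Sum>i\<le>n + 1. (- 1) ^ (n + 1 - i) * fact n * real (a * b) ^ (n + 1 - i)
                        * bernoulli i * bernoulli (n + 1 - i) / (fact i * fact (n + 1 - i)))
          + real n * bernoulli (n + 1) / real (n + 1)"
proof -
  define f where "f = bernoulli_fun n"
  \<comment> \<open>This is the power of \<open>c\<close> with exponent \<open>n - 1\<close>,
    written as a quotient so that \<open>n = 0\<close> gives \<open>1 / c\<close>.\<close>
  define \<alpha> where "\<alpha> c = real c ^ n / real c" for c
  have N: "a * b > 0" using assms by simp
  have raabe: "f (real i * real c / real d) = \<alpha> c * (\<Sum>j<c. f (real i / real d + real j / real c))"
    if "c > 0" for c d i
  proof -
    define S where "S = (\<Sum>j<c. f (real i / real d + real j / real c))"
    have "real c * f (real c * (real i / real d)) = real c ^ n * S"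
      unfolding S_def f_def by (rule bernoulli_fun_multiplication[OF that])
    also have "real c * (real i / real d) = real i * real c / real d" by simp
    finally have "f (real i * real c / real d) = \<alpha> c * S"
      using that by (simp add: \<alpha>_def nonzero_eq_divide_eq mult.commute)
    then show ?thesis by (simp only: S_def)
  qed
  have fa: "\<forall>i<b. f (real i * real a / real b) = \<alpha> a * (\<Sum>j<a. f (real i / real b + real j / real a)) + 0"
    using raabe[OF assms(1)] by simp
  have fb: "\<forall>j<a. f (real j * real b / real a) = \<alpha> b * (\<Sum>i<b. f (real i / real b + real j / real a)) + 0"
    using raabe[OF assms(2)] by (simp add: add.commute)
  have per: "\<forall>x. f (x + 1) = f x"
    using bernoulli_fun_add_of_int[of n _ 1] by (simp add: f_def)
  have *: "\<alpha> b * apostol_dedekind n a b + \<alpha> a * apostol_dedekind n b a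
     = \<alpha> a * \<alpha> b * (\<Sum>k\<in>gaps a b. f (real k / real (a * b)))
       + \<alpha> a * \<alpha> b * (\<Sum>k<a * b. real k / real (a * b) * f (real k / real (a * b)))"
    using reciprocity_periodic[OF assms fa fb per] by (simp add: apostol_dedekind_eq f_def)
  \<comment> \<open>Multiplication by \<open>a * b\<close> turns the factors \<open>\<alpha>\<close>
    into the weights of the claim.\<close>
  have \<alpha>: "real a * real b * \<alpha> b = real a * real b ^ n" "real a * real b * \<alpha> a = real b * real a ^ n"
    "real a * real b * (\<alpha> a * \<alpha> b) = real (a * b) ^ n"
    using assms by (simp_all add: \<alpha>_def power_mult_distrib)
  have "real a * real b ^ n * apostol_dedekind n a b + real b * real a ^ n * apostol_dedekind n b a
      = real a * real b * (\<alpha> b * apostol_dedekind n a b + \<alpha> a * apostol_dedekind n b a)"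
    unfolding \<alpha>[symmetric] by (simp add: algebra_simps)
  also have "\<dots> = real (a * b) ^ n * (\<Sum>k\<in>gaps a b. f (real k / real (a * b)))
       + real (a * b) ^ n * (\<Sum>k<a * b. real k / real (a * b) * f (real k / real (a * b)))"
    unfolding * \<alpha>(3)[symmetric] by (simp only: distrib_left mult.assoc)
  also have "(\<Sum>k<a * b. real k / real (a * b) * f (real k / real (a * b)))
      = (\<Sum>k<a * b. real k / real (a * b) * bernoulli_poly n (real k / real (a * b)))"
  proof (rule sum.cong)
    fix k assume "k \<in> {..<a * b}"
    then have "real k < real (a * b)" by (simp del: of_nat_mult)
    then have "f (real k / real (a * b)) = bernoulli_poly n (real k / real (a * b))"
      unfolding f_def by (intro bernoulli_fun_eq_poly) (simp_all add: divide_less_eq del: of_nat_mult)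
    then show "real k / real (a * b) * f (real k / real (a * b))
      = real k / real (a * b) * bernoulli_poly n (real k / real (a * b))" by simp
  qed simp
  finally show ?thesis
    unfolding f_def sum_gaps_bernoulli_fun[OF assms] sum_weighted_bernoulli_poly[OF N]
    by (simp only: add.assoc)
qed

text \<open>The signs only matter for the factor \<open>B_1\<close>, whose cofactor \<open>B_n\<close> vanishes.\<close>
lemma sum_bernoulli_sign_odd:
  assumes "odd n" "n \<ge> 3"
  shows "(\<Sum>i\<le>n + 1. (- 1) ^ (n + 1 - i) * fact n * x ^ (n + 1 - i)
            * bernoulli i * bernoulli (n + 1 - i) / (fact i * fact (n + 1 - i)))
    = (\<Sum>i\<le>n + 1. fact n * x ^ (n + 1 - i)
            * bernoulli i * bernoulli (n + 1 - i) / (fact i * fact (n + 1 - i)))"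
proof (rule sum.cong)
  fix i assume "i \<in> {..n + 1}"
  then have "i \<le> n + 1" by simp
  have "(- 1) ^ (n + 1 - i) * (bernoulli i * bernoulli (n + 1 - i)) = bernoulli i * bernoulli (n + 1 - i)"
  proof (cases "n + 1 - i = 1")
    case True
    then have "i = n" by simp
    with assms show ?thesis using bernoulli_odd_eq_0[of n] by simp
  next
    case False
    then show ?thesis using bernoulli_odd_eq_0[of "n + 1 - i"] by (cases "even (n + 1 - i)") auto
  qed
  then have "(- 1) ^ (n + 1 - i) * (bernoulli i * bernoulli (n + 1 - i))
      * (fact n * x ^ (n + 1 - i) / (fact i * fact (n + 1 - i)))
    = bernoulli i * bernoulli (n + 1 - i) * (fact n * x ^ (n + 1 - i) / (fact i * fact (n + 1 - i)))"
    by simp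
  then show "(- 1) ^ (n + 1 - i) * fact n * x ^ (n + 1 - i)
            * bernoulli i * bernoulli (n + 1 - i) / (fact i * fact (n + 1 - i))
    = fact n * x ^ (n + 1 - i) * bernoulli i * bernoulli (n + 1 - i) / (fact i * fact (n + 1 - i))"
    by (simp only: mult_ac times_divide_eq_left times_divide_eq_right)
qed simp

text \<open>The last formula appears twice. The signed right-hand side, valid for every
  \<open>n\<close>, exceeds the unsigned one by \<open>a * b * bernoulli n\<close>: only the term
  \<open>i = n\<close>, with cofactor \<open>B_1 = -1/2\<close>, is affected by its sign. The
  unsigned form therefore holds exactly when \<open>bernoulli n\<close> vanishes, that is, for odd
  \<open>n \<ge> 3\<close>.\<close>

theorem mainTheorem3:
  fixes a b :: nat
  assumes "a > 0" and "b > 0" and "coprime a b"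
  shows
    "(\<forall>(f :: real \<Rightarrow> 'a :: field_char_0) \<alpha>a \<alpha>b \<beta>a \<beta>b.
        (\<forall>i<b. f (real i * real a / real b) =
                 \<alpha>a * (\<Sum>j<a. f (real i / real b + real j / real a)) + \<beta>a) \<longrightarrow>
        (\<forall>j<a. f (real j * real b / real a) =
                 \<alpha>b * (\<Sum>i<b. f (real i / real b + real j / real a)) + \<beta>b) \<longrightarrow>
        \<alpha>b * (\<Sum>i<b. of_nat i / of_nat b * f (real i * real a / real b))
          + \<alpha>a * (\<Sum>j<a. of_nat j / of_nat a * f (real j * real b / real a))
        = \<alpha>a * \<alpha>b * (\<Sum>k\<in>gaps a b.
              (of_nat k / of_nat (a * b) + 1) * f (real k / real (a * b) + 1)
              - of_nat k / of_nat (a * b) * f (real k / real (a * b)))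
          + \<alpha>a * \<alpha>b * (\<Sum>k<a * b. of_nat k / of_nat (a * b) * f (real k / real (a * b)))
          + \<alpha>b * \<beta>a * (of_nat b - 1) / 2 + \<alpha>a * \<beta>b * (of_nat a - 1) / 2)
   \<and> (\<forall>(f :: real \<Rightarrow> 'a) \<alpha>a \<alpha>b \<beta>a \<beta>b.
        (\<forall>i<b. f (real i * real a / real b) =
                 \<alpha>a * (\<Sum>j<a. f (real i / real b + real j / real a)) + \<beta>a) \<longrightarrow>
        (\<forall>j<a. f (real j * real b / real a) =
                 \<alpha>b * (\<Sum>i<b. f (real i / real b + real j / real a)) + \<beta>b) \<longrightarrow>
        (\<forall>x. f (x + 1) = f x) \<longrightarrow>
        \<alpha>b * (\<Sum>i<b. of_nat i / of_nat b * f (real i * real a / real b))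
          + \<alpha>a * (\<Sum>j<a. of_nat j / of_nat a * f (real j * real b / real a))
        = \<alpha>a * \<alpha>b * (\<Sum>k\<in>gaps a b. f (real k / real (a * b)))
          + \<alpha>a * \<alpha>b * (\<Sum>k<a * b. of_nat k / of_nat (a * b) * f (real k / real (a * b)))
          + \<alpha>b * \<beta>a * (of_nat b - 1) / 2 + \<alpha>a * \<beta>b * (of_nat a - 1) / 2)
   \<and> (\<forall>n. odd n \<and> n \<ge> 3 \<longrightarrow>
        real a * real b ^ n * apostol_dedekind n a b
          + real b * real a ^ n * apostol_dedekind n b a
        = (\<Sum>i\<le>n. real (n choose i) * real (a * b) ^ i * bernoulli i * sylvester_sum a b (n - i))
          + (\<Sum>i\<le>n + 1. fact n * real (a * b) ^ (n + 1 - i) * bernoulli i * bernoulli (n + 1 - i)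
                        / (fact i * fact (n + 1 - i)))
          + real n * bernoulli (n + 1) / real (n + 1))
   \<and> (\<forall>n. real a * real b ^ n * apostol_dedekind n a b
          + real b * real a ^ n * apostol_dedekind n b a
        = (\<Sum>i\<le>n. real (n choose i) * real (a * b) ^ i * bernoulli i * sylvester_sum a b (n - i))
          + (\<Sum>i\<le>n + 1. (- 1) ^ (n + 1 - i) * fact n * real (a * b) ^ (n + 1 - i)
                        * bernoulli i * bernoulli (n + 1 - i) / (fact i * fact (n + 1 - i)))
          + real n * bernoulli (n + 1) / real (n + 1))"
proof (intro conjI allI impI, goal_cases)
  case (1 f \<alpha>a \<alpha>b \<beta>a \<beta>b)
  then show ?case by (rule reciprocity_general[OF assms])
next
  case (2 f \<alpha>a \<alpha>b \<beta>a \<beta>b)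
  then show ?case by (rule reciprocity_periodic[OF assms])
next
  case (3 n)
  then have n: "odd n" "n \<ge> 3" by simp_all
  show ?case
    unfolding apostol_dedekind_reciprocity[OF assms] sum_bernoulli_sign_odd[OF n] by (rule refl)
next
  case (4 n)
  show ?case by (rule apostol_dedekind_reciprocity[OF assms])
qed

end
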